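(* Let $\mathbb{A}$ and $\mathbb{B}$ be finite non-empty sets, $k\ge2$ an integer, and $\tau:\mathbb{A}\to\mathbb{B}^*$ a morphism. If $x\in\mathbb{A}^{\mathbb{N}}$ is $k$-self-shuffling and $\tau(x)\in\mathbb{B}^{\mathbb{N}}$ (that is, $\tau(x)$ is an infinite word), then $\tau(x)$ is $k$-self-shuffling.
   Context: A morphism $\tau:\mathbb{A}\to\mathbb{B}^*$ is a map assigning to each letter a finite word over $\mathbb{B}$, extended to finite and infinite words by concatenation. A word $x\in\mathbb{A}^{\mathbb{N}}$ is $k$-self-shuffling if there exist finite (possibly empty) words $U_i^{(j)}\in\mathbb{A}^*$, $i\ge0$, $1\le j\le k$, such that $x=\prod_{i=0}^\infty U_i^{(1)}U_i^{(2)}\cdots U_i^{(k)}$ and $x=\prod_{i=0}^\infty U_i^{(j)}$ for each $j=1,\dots,k$. Equivalently, $\mathbb{N}$ can be partitioned into $k$ infinite subsets $N^1,\dots,N^k$ with $x[N^j]=x$ for each $j$, where for $N=\{N_0<N_1<\cdots\}$ one puts $x[N]=x_{N_0}x_{N_1}x_{N_2}\cdots$. *)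

theory Defs
  imports "HOL-Library.Omega_Words_Fun" "HOL-Library.FuncSet"
begin

text \<open>
  \<open>infinite_product W x\<close> says that \<open>W 0 W 1 W 2 \<dots>\<close> is an infinite word and equals \<open>x\<close>.
  Factors may be empty. Without the second conjunct, a product with only finitely many nonempty
  factors, which is a finite word, would be related to each of its infinite extensions.
\<close>

definition infinite_product :: "(nat \<Rightarrow> 'a list) \<Rightarrow> 'a word \<Rightarrow> bool" where
  "infinite_product W x \<longleftrightarrow>
     (\<forall>n. concat (map W [0..<n]) = prefix (length (concat (map W [0..<n]))) x) \<and>
     (\<forall>m. \<exists>n. m \<le> length (concat (map W [0..<n])))"

text \<open>
  The image of \<open>x\<close> under the morphism \<open>\<tau>\<close> is the product \<open>\<tau> (x 0) \<tau> (x 1) \<dots>\<close>. Since \<open>\<tau>\<close> may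
  erase letters, this can be a finite word, so \<open>y = \<tau>(x)\<close> for an infinite word \<open>y\<close> is a relation.
\<close>

definition morphic_image :: "('a \<Rightarrow> 'b list) \<Rightarrow> 'a word \<Rightarrow> 'b word \<Rightarrow> bool" where
  "morphic_image \<tau> x y \<longleftrightarrow> infinite_product (\<lambda>i. \<tau> (x i)) y"

definition self_shuffling :: "'a set \<Rightarrow> nat \<Rightarrow> 'a word \<Rightarrow> bool" where
  "self_shuffling A k x \<longleftrightarrow>
     (\<exists>U :: nat \<Rightarrow> nat \<Rightarrow> 'a list.
        (\<forall>i. \<forall>j\<in>{1..k}. U i j \<in> lists A) \<and>
        infinite_product (\<lambda>i. concat (map (U i) [1..<Suc k])) x \<and>
        (\<forall>j\<in>{1..k}. infinite_product (\<lambda>i. U i j) x))"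

lemma infinite_product_unique:
  assumes "infinite_product W x" "infinite_product W y"
  shows "x = y"
proof
  fix m
  obtain n where n: "Suc m \<le> length (concat (map W [0..<n]))" (is "_ \<le> ?l")
    using assms(1) unfolding infinite_product_def by blast
  have "prefix ?l x = prefix ?l y"
    using assms unfolding infinite_product_def by metis
  then have "prefix ?l x ! m = prefix ?l y ! m" by simp
  with n show "x m = y m" by simp
qed

lemma ex_infinite_product_iff:
  "(\<exists>x. infinite_product W x) \<longleftrightarrow> (\<exists>\<^sub>\<infinity>i. W i \<noteq> [])"
proof -
  let ?P = "\<lambda>n. concat (map W [0..<n])"
  have ext: "\<exists>w. ?P (n + d) = ?P n @ w" for n d
    by (induction d) auto
  have ext': "\<exists>w. ?P n' = ?P n @ w" if "n \<le> n'" for n n'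
    using ext[of n "n' - n"] that by simp
  show ?thesis
  proof
    assume "\<exists>x. infinite_product W x"
    then have long: "\<exists>n. m \<le> length (?P n)" for m
      unfolding infinite_product_def by blast
    show "\<exists>\<^sub>\<infinity>i. W i \<noteq> []"
      unfolding INFM_nat
    proof (rule allI, rule ccontr)
      fix m
      assume "\<not> (\<exists>n>m. W n \<noteq> [])"
      then have empty: "W n = []" if "m < n" for n using that by blast
      have stop: "?P (Suc m + d) = ?P (Suc m)" for d
        by (induction d) (auto simp: empty)
      obtain n where n: "Suc (length (?P (Suc m))) \<le> length (?P n)" using long by blast
      show False
      proof (cases "n \<le> Suc m")
        case True
        then obtain w where "?P (Suc m) = ?P n @ w" using ext' by blast
        then have "length (?P (Suc m)) = length (?P n) + length w" by (metis length_append)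
        with n show False by linarith
      next
        case False
        then have "?P n = ?P (Suc m)" using stop[of "n - Suc m"] by simp
        with n show False by simp
      qed
    qed
  next
    assume inf: "\<exists>\<^sub>\<infinity>i. W i \<noteq> []"
    have long: "\<exists>n. m \<le> length (?P n)" for m
    proof (induction m)
      case 0
      then show ?case by simp
    next
      case (Suc m)
      then obtain n where n: "m \<le> length (?P n)" by blast
      obtain i where i: "n < i" "W i \<noteq> []" using inf unfolding INFM_nat by blast
      obtain w where "?P i = ?P n @ w" using ext'[of n i] i by auto
      then have "length (?P n) \<le> length (?P i)" by (metis length_append le_add1)
      moreover have "length (?P (Suc i)) = length (?P i) + length (W i)" by simp
      moreover have "0 < length (W i)" using i by simp
      ultimately have "Suc m \<le> length (?P (Suc i))" using n by linarith
      then show ?case by blast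
    qed
    then have "\<forall>m. \<exists>n. Suc m \<le> length (?P n)" by blast
    from choice[OF this] obtain N where N: "\<And>m. Suc m \<le> length (?P (N m))" by blast
    define x where "x m = ?P (N m) ! m" for m
    have x: "?P n ! m = x m" if "m < length (?P n)" for n m
    proof (cases "n \<le> N m")
      case True
      then obtain w where "?P (N m) = ?P n @ w" using ext' by blast
      then show ?thesis using that unfolding x_def by (metis nth_append_left)
    next
      case False
      then obtain w where "?P n = ?P (N m) @ w" using ext'[of "N m" n] by auto
      then show ?thesis using N[of m] unfolding x_def by (metis nth_append_left Suc_le_lessD)
    qed
    have "?P n = prefix (length (?P n)) x" for n
    proof (rule nth_equalityI)
      show "length (?P n) = length (prefix (length (?P n)) x)" by simp
      show "?P n ! m = prefix (length (?P n)) x ! m" if "m < length (?P n)" for m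
        using x[OF that] that by simp
    qed
    with long show "\<exists>x. infinite_product W x"
      unfolding infinite_product_def by blast
  qed
qed

end

theory Submission
  imports Defs
begin

text \<open>
  A morphism carries every factorization of \<open>x\<close> to a factorization of \<open>\<tau>(x)\<close>, because it
  commutes with finite concatenation. Hence the words \<open>\<tau> (U i j)\<close> witness that \<open>\<tau>(x)\<close> is
  self-shuffling whenever the words \<open>U i j\<close> do so for \<open>x\<close>: both the factorization of \<open>x\<close> into
  the blocks \<open>U i 1 \<dots> U i k\<close> and the \<open>k\<close> factorizations into the words \<open>U i j\<close> with \<open>j\<close> fixed
  are transported. The only point that needs care is that \<open>\<tau>\<close> may erase letters, so that a
  transported product could be finite a priori. It is not, since it is cofinal
  with the product of the words \<open>\<tau> (x i)\<close>, which is infinite by hypothesis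
  (\<open>infinite_product_morphic_image\<close>).
\<close>

lemma concat_map_concat:
  "concat (map f (concat ws)) = concat (map (\<lambda>w. concat (map f w)) ws)"
  by (induction ws) simp_all

lemma length_concat_map_upt_mono:
  assumes "m \<le> n"
  shows "length (concat (map W [0..<m])) \<le> length (concat (map W [0..<n]))"
  using assms by (induction rule: dec_induct) simp_all

text \<open>
  Each partial product of \<open>W\<close> is a prefix of \<open>x\<close>, so its image is a partial product of the words
  \<open>\<tau> (x i)\<close>. The prefixes of \<open>x\<close> obtained in this way are arbitrarily long, so their images
  eventually exceed any partial product of the words \<open>\<tau> (x i)\<close> in length.
\<close>

lemma infinite_product_morphic_image:
  assumes W: "infinite_product W x" and y: "morphic_image \<tau> x y"
  shows "infinite_product (\<lambda>i. concat (map \<tau> (W i))) y"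
proof -
  let ?L = "\<lambda>n. length (concat (map W [0..<n]))"
  let ?V = "\<lambda>n. concat (map (\<lambda>i. concat (map \<tau> (W i))) [0..<n])"
  let ?Y = "\<lambda>l. concat (map (\<lambda>i. \<tau> (x i)) [0..<l])"
  have V: "?V n = ?Y (?L n)" for n
  proof -
    have "?V n = concat (map \<tau> (concat (map W [0..<n])))"
      by (simp add: concat_map_concat comp_def)
    also have "\<dots> = concat (map \<tau> (prefix (?L n) x))"
      using W unfolding infinite_product_def by metis
    also have "\<dots> = ?Y (?L n)"
      by (simp add: subsequence_def comp_def)
    finally show ?thesis .
  qed
  have "\<exists>n. m \<le> length (?V n)" for m
  proof -
    obtain l where l: "m \<le> length (?Y l)"
      using y unfolding morphic_image_def infinite_product_def by blast
    obtain n where "l \<le> ?L n"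
      using W unfolding infinite_product_def by blast
    then have "length (?Y l) \<le> length (?Y (?L n))"
      by (rule length_concat_map_upt_mono)
    with l V show ?thesis by (metis le_trans)
  qed
  moreover have "?V n = prefix (length (?V n)) y" for n
    using y unfolding V morphic_image_def infinite_product_def by blast
  ultimately show ?thesis
    unfolding infinite_product_def by blast
qed

theorem proposition2p2:
  fixes A :: "'a set" and B :: "'b set" and k :: nat
    and \<tau> :: "'a \<Rightarrow> 'b list" and x :: "'a word" and y :: "'b word"
  assumes "finite A" and "A \<noteq> {}"
    and "finite B" and "B \<noteq> {}"
    and "k \<ge> 2"
    and "\<tau> \<in> A \<rightarrow> lists B"
    and "range x \<subseteq> A"
    and "self_shuffling A k x"
    and "range y \<subseteq> B"
    and "morphic_image \<tau> x y"
  shows "self_shuffling B k y"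
proof -
  obtain U :: "nat \<Rightarrow> nat \<Rightarrow> 'a list" where
      letters: "\<forall>i. \<forall>j\<in>{1..k}. U i j \<in> lists A"
    and blocks: "infinite_product (\<lambda>i. concat (map (U i) [1..<Suc k])) x"
    and tracks: "\<forall>j\<in>{1..k}. infinite_product (\<lambda>i. U i j) x"
    using assms(8) unfolding self_shuffling_def by blast
  let ?V = "\<lambda>i j. concat (map \<tau> (U i j))"
  have "\<forall>i. \<forall>j\<in>{1..k}. ?V i j \<in> lists B"
    using letters assms(6) by (fastforce simp: in_lists_conv_set Pi_iff)
  moreover have "infinite_product (\<lambda>i. concat (map (?V i) [1..<Suc k])) y"
    using infinite_product_morphic_image[OF blocks assms(10)]
    by (simp only: concat_map_concat map_map comp_def)
  moreover have "\<forall>j\<in>{1..k}. infinite_product (\<lambda>i. ?V i j) y"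
    using tracks infinite_product_morphic_image assms(10) by blast
  ultimately show ?thesis
    unfolding self_shuffling_def by (intro exI[of _ ?V] conjI)
qed

end
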